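(* For every $n,\Delta\in\mathbb Z$ with $n\ge2$, $\Delta\ge1$, and every $\epsilon\in(0,1]$, there exists an instance of (IQP) in $n$ variables with subdeterminant $\Delta$ and $k=n$ for which $$\delta^*_\epsilon\ \ge\ 4\left(\frac1\epsilon-1\right)+\frac23(n-1)\Delta\quad\in\ \Omega\left(\frac1\epsilon+n\Delta\right),$$ where $$\delta^*_\epsilon:=\min\{\|x^c-x^*\|_\infty : x^*\ \epsilon\text{-approximate solution to (IQP)},\ x^c \text{ optimal solution to (QP)}\}$$ and (QP) is the continuous problem corresponding to (IQP).
   Context: An instance of (IQP) is a problem $\min\{f(x): Ax\le b,\ x\in\mathbb Z^n\}$ with $f(x)=\sum_{i=1}^k -q_i x_i^2+h^{\mathsf T}x$, where $0\le k\le n$, $q_i>0$ for $i=1,\dots,k$, $A$ is an integer matrix with $n$ columns, and $q_i$, $h$, $b$ are real. The corresponding (QP) is $\min\{f(x): Ax\le b,\ x\in\mathbb R^n\}$. The instance has subdeterminant $\Delta$ if the maximum of the absolute values of the subdeterminants (determinants of square submatrices) of $A$ is $\Delta$. $\epsilon$-approximate solution: for a problem $\min\{f(x): x\in S\}$, $S\subseteq\mathbb R^n$, having an optimal solution $x^{\mathrm{opt}}$, let $f_{\max}$ be the maximum value of $f$ on $S$. For $\epsilon\in[0,1]$, a feasible point $x^*\in S$ is an $\epsilon$-approximate solution if $f(x^* )-f(x^{\mathrm{opt}})\le\epsilon\,(f_{\max}-f(x^{\mathrm{opt}}))$. If $f$ is unbounded above on $S$, every feasible point is an $\epsilon$-approximate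 solution for every $\epsilon>0$. The definition of $\delta^*_\epsilon$ is for instances in which both (IQP) and (QP) have an optimal solution (which is part of what is asserted to exist). The notation $g\in\Omega(h)$ means there are constants $c,C>0$, independent of $n,\Delta,\epsilon$, with $g\ge c\,h$ whenever $h\ge C$. *)

theory Defs
  imports Complex_Main
    "Jordan_Normal_Form.Matrix"
    "Jordan_Normal_Form.Determinant"
    "Jordan_Normal_Form.DL_Submatrix"
begin

(* Variables are numbered from 0, so the concave square terms are those of x_0, ..., x_(k-1). *)
record iqp =
  nvars :: nat
  nconc :: nat
  quad  :: "real vec"
  lin   :: "real vec"
  cmat  :: "int mat"
  rhs   :: "real vec"

definition is_instance :: "iqp \<Rightarrow> bool" where
  "is_instance P \<longleftrightarrow>
     nconc P \<le> nvars P \<and>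
     quad P \<in> carrier_vec (nconc P) \<and>
     (\<forall>i < nconc P. quad P $ i > 0) \<and>
     lin P \<in> carrier_vec (nvars P) \<and>
     cmat P \<in> carrier_mat (dim_vec (rhs P)) (nvars P)"

definition objective :: "iqp \<Rightarrow> real vec \<Rightarrow> real" where
  "objective P x = (\<Sum>i < nconc P. - (quad P $ i) * (x $ i)\<^sup>2) + lin P \<bullet> x"

definition QP_feasible :: "iqp \<Rightarrow> real vec set" where
  "QP_feasible P =
     {x \<in> carrier_vec (nvars P). map_mat real_of_int (cmat P) *\<^sub>v x \<le> rhs P}"

definition IQP_feasible :: "iqp \<Rightarrow> real vec set" where
  "IQP_feasible P = {x \<in> QP_feasible P. \<forall>i < nvars P. x $ i \<in> \<int>}"

(* Absolute values of the determinants of the nonempty square submatrices. *)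
definition abs_subdets :: "int mat \<Rightarrow> int set" where
  "abs_subdets A =
     {\<bar>det (submatrix A I J)\<bar> | I J.
        I \<subseteq> {..<dim_row A} \<and> J \<subseteq> {..<dim_col A} \<and> card I = card J \<and> I \<noteq> {}}"

definition has_subdeterminant :: "iqp \<Rightarrow> int \<Rightarrow> bool" where
  "has_subdeterminant P \<Delta> \<longleftrightarrow>
     \<Delta> \<in> abs_subdets (cmat P) \<and> (\<forall>d \<in> abs_subdets (cmat P). d \<le> \<Delta>)"

definition optimal :: "('a \<Rightarrow> real) \<Rightarrow> 'a set \<Rightarrow> 'a \<Rightarrow> bool" where
  "optimal f S x \<longleftrightarrow> is_arg_min f (\<lambda>y. y \<in> S) x"

(* The supremum below is the maximum of f on S whenever that maximum is attained. *)
definition eps_approximate :: "real \<Rightarrow> ('a \<Rightarrow> real) \<Rightarrow> 'a set \<Rightarrow> 'a \<Rightarrow> bool" where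
  "eps_approximate \<epsilon> f S x \<longleftrightarrow>
     x \<in> S \<and>
     (\<exists>xopt. optimal f S xopt \<and>
        (if bdd_above (f ` S)
         then f x - f xopt \<le> \<epsilon> * ((SUP y \<in> S. f y) - f xopt)
         else \<epsilon> > 0))"

(* The inserted 0 only matters in dimension 0. *)
definition linf_norm :: "real vec \<Rightarrow> real" where
  "linf_norm v = Max (insert 0 ((\<lambda>i. \<bar>v $ i\<bar>) ` {..<dim_vec v}))"

definition proximity_distances :: "iqp \<Rightarrow> real \<Rightarrow> real set" where
  "proximity_distances P \<epsilon> =
     {linf_norm (xc - xs) | xc xs.
        eps_approximate \<epsilon> (objective P) (IQP_feasible P) xs \<and>
        optimal (objective P) (QP_feasible P) xc}"

(* All distances are bounded below by 0, so this infimum is the minimum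
   exactly if it belongs to the set of distances. *)
definition delta_star :: "iqp \<Rightarrow> real \<Rightarrow> real" where
  "delta_star P \<epsilon> = Inf (proximity_distances P \<epsilon>)"

end

theory Submission
  imports Defs
begin

text \<open>
  Write \<open>s = n - 1\<close> and take the constraints \<open>0 \<le> x\<^sub>i\<close>, \<open>x\<^sub>0 \<le> 2/3\<close>, \<open>x\<^sub>i - x\<^sub>i\<^sub>-\<^sub>1 \<le> 2/3\<close> for
  \<open>0 < i < s\<close>, and \<open>x\<^sub>s - \<Delta> x\<^sub>s\<^sub>-\<^sub>1 \<le> N + 1/2\<close>. Each step of the ladder is too short for an integer
  point to climb, so the integer points are \<open>(0,\<dots>,0,j)\<close> with \<open>0 \<le> j \<le> N\<close>, while the real
  points reach the vertex where every step is used in full; its last coordinate exceeds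
  \<open>N + 2/3 s \<Delta>\<close>. For the objective \<open>(N + 1) x\<^sub>s - \<Sum>x\<^sub>i\<^sup>2\<close> that vertex is the only continuous
  optimum. On the integer points the objective is \<open>j (N + 1 - j)\<close>: it is \<open>0\<close> at the optimum \<open>j = 0\<close>,
  at least \<open>N\<close> at all others and at most \<open>(N + 1)\<^sup>2 / 4\<close>, so for \<open>N = \<lceil>4 (1/\<epsilon> - 1)\<rceil>\<close> the only
  \<open>\<epsilon>\<close>-approximate solution is \<open>0\<close>.
\<close>

section \<open>Subdeterminants of the constraint matrix\<close>

text \<open>The rows \<open>i < n\<close> encode \<open>x\<^sub>i - w\<^sub>i x\<^sub>i\<^sub>-\<^sub>1\<close>, the rows \<open>n + i\<close> encode \<open>- x\<^sub>i\<close>.\<close>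
definition ladder_entry :: "nat \<Rightarrow> (nat \<Rightarrow> int) \<Rightarrow> nat \<Rightarrow> nat \<Rightarrow> int" where
  "ladder_entry n w i j =
     (if i < n then (if j = i then 1 else if Suc j = i then - w i else 0)
      else if n + j = i then - 1 else 0)"

lemma abs_ladder_entry_le:
  assumes "1 \<le> w i"
  shows "\<bar>ladder_entry n w i j\<bar> \<le> w i"
  using assms by (auto simp: ladder_entry_def)

text \<open>Induction on the size: the leftmost selected column can always be removed at the cost of
  one factor \<open>w (r a)\<close>, because expansion along a suitable row or along this column
  leaves at most one term. The minor is given by index functions, \<open>r\<close> injective and
  \<open>c\<close> increasing, since this form survives the deletion of any row together with the
  first column.\<close>

lemma abs_det_ladder_minor_le:
  assumes "\<And>i. 1 \<le> w i"
    and "M \<in> carrier_mat k k"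
    and "inj_on r {..<k}"
    and "\<And>i j. i < j \<Longrightarrow> j < k \<Longrightarrow> c i < c j"
    and "\<And>j. j < k \<Longrightarrow> c j < n"
    and "\<And>i j. i < k \<Longrightarrow> j < k \<Longrightarrow> M $$ (i, j) = ladder_entry n w (r i) (c j)"
  shows "\<bar>det M\<bar> \<le> (\<Prod>i<k. w (r i))"
  using assms(2-)
proof (induction k arbitrary: M r c)
  case 0
  then show ?case by simp
next
  case (Suc k)
  note M = Suc.prems(1) and inj = Suc.prems(2) and mono = Suc.prems(3)
    and lt = Suc.prems(4) and entry = Suc.prems(5)
  have wpos: "0 \<le> (\<Prod>i\<in>A. w (r i))" for A
    by (rule prod_nonneg) (meson assms(1) order_trans zero_le_one)
  \<comment> \<open>Both expansions below reduce \<open>det M\<close> to one such term or to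
    \<open>0\<close>. The smaller minor has row indices \<open>r \<circ> insert_index a\<close>,
    which skip \<open>r a\<close>, so its bound lacks exactly the factor
    \<open>w (r a)\<close>.\<close>
  have bound: "\<bar>M $$ (a, 0) * cofactor M a 0\<bar> \<le> (\<Prod>i<Suc k. w (r i))" if a: "a < Suc k" for a
  proof -
    have "\<bar>det (mat_delete M a 0)\<bar> \<le> (\<Prod>i<k. w ((r \<circ> insert_index a) i))"
    proof (rule Suc.IH)
      show "mat_delete M a 0 \<in> carrier_mat k k"
        using mat_delete_carrier[OF M] by simp
      have im: "insert_index a ` {..<k} = {..<Suc k} - {a}"
        using insert_index_image[OF a] by (simp add: lessThan_atLeast0)
      show "inj_on (r \<circ> insert_index a) {..<k}"
        by (rule comp_inj_on[OF insert_index_inj_on]) (use im inj in \<open>auto intro: inj_on_subset\<close>)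
      show "(c \<circ> Suc) i < (c \<circ> Suc) j" if "i < j" "j < k" for i j
        using that mono by simp
      show "(c \<circ> Suc) j < n" if "j < k" for j
        using that lt by simp
      show "mat_delete M a 0 $$ (i, j) = ladder_entry n w ((r \<circ> insert_index a) i) ((c \<circ> Suc) j)"
        if "i < k" "j < k" for i j
        using that mat_delete_index[OF M a, of 0 i j, symmetric] entry[of "insert_index a i" "Suc j"]
        by (auto simp: insert_index_def)
    qed
    also have "\<dots> = (\<Prod>i\<in>{..<Suc k} - {a}. w (r i))"
      using prod.reindex[OF insert_index_inj_on[of a "{0..<k}"], of "\<lambda>i. w (r i)"]
        insert_index_image[OF a] by (simp add: lessThan_atLeast0)
    finally have "\<bar>cofactor M a 0\<bar> \<le> (\<Prod>i\<in>{..<Suc k} - {a}. w (r i))"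
      by (simp add: cofactor_def abs_mult power_abs)
    moreover have "\<bar>M $$ (a, 0)\<bar> \<le> w (r a)"
      using a by (simp add: entry abs_ladder_entry_le assms(1))
    ultimately have "\<bar>M $$ (a, 0) * cofactor M a 0\<bar> \<le> w (r a) * (\<Prod>i\<in>{..<Suc k} - {a}. w (r i))"
      unfolding abs_mult by (intro mult_mono) (use assms(1)[of "r a"] in auto)
    also have "\<dots> = (\<Prod>i<Suc k. w (r i))"
      using a prod.remove[of "{..<Suc k}" a "\<lambda>i. w (r i)"] by simp
    finally show ?thesis .
  qed
  show ?case
  proof (cases "\<exists>a<Suc k. r a = c 0 \<or> r a = n + c 0")
    case True
    text \<open>The columns left of \<open>c 0\<close> are not selected, so this row has a single nonzero entry.\<close>
    then obtain a where a: "a < Suc k" "r a = c 0 \<or> r a = n + c 0" by blast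
    have "M $$ (a, j) = 0" if "j < Suc k" "j \<noteq> 0" for j
      using a that lt[of 0] mono[of 0 j] by (auto simp: entry ladder_entry_def)
    then have "(\<Sum>j<Suc k. M $$ (a, j) * cofactor M a j)
        = (\<Sum>j\<in>{0}. M $$ (a, j) * cofactor M a j)"
      by (intro sum.mono_neutral_right) auto
    then have "det M = M $$ (a, 0) * cofactor M a 0"
      using laplace_expansion_row[OF M a(1)] by simp
    then show ?thesis using bound[OF a(1)] by simp
  next
    case False
    \<comment> \<open>Only the subdiagonal entry of column \<open>c 0\<close> can now be nonzero; by
      injectivity of \<open>r\<close> it is selected at most once.\<close>
    have col: "M $$ (i, 0) = 0" if "i < Suc k" "r i \<noteq> Suc (c 0)" for i
      using False that by (auto simp: entry ladder_entry_def)
    have exp: "det M = (\<Sum>i<Suc k. M $$ (i, 0) * cofactor M i 0)"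
      using laplace_expansion_column[OF M, of 0] by simp
    show ?thesis
    proof (cases "\<exists>a<Suc k. r a = Suc (c 0)")
      case True
      then obtain a where a: "a < Suc k" "r a = Suc (c 0)" by blast
      have "M $$ (i, 0) = 0" if "i < Suc k" "i \<noteq> a" for i
        using col[OF that(1)] inj_onD[OF inj, of i a] that a by auto
      then have "(\<Sum>i<Suc k. M $$ (i, 0) * cofactor M i 0) = (\<Sum>i\<in>{a}. M $$ (i, 0) * cofactor M i 0)"
        by (intro sum.mono_neutral_right) (use a in auto)
      then show ?thesis using bound[OF a(1)] exp by simp
    next
      case False
      then have "det M = 0" unfolding exp by (intro sum.neutral) (auto simp: col)
      then show ?thesis using wpos[of "{..<Suc k}"] by (simp del: prod.lessThan_Suc)
    qed
  qed
qed

definition ladder_mat :: "nat \<Rightarrow> (nat \<Rightarrow> int) \<Rightarrow> int mat" where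
  "ladder_mat n w = mat (2 * n) n (\<lambda>(i, j). ladder_entry n w i j)"

text \<open>Only row \<open>s\<close> has a weight other than \<open>1\<close>, and a submatrix
  selects each row at most once, so the product bounding its determinant is \<open>D\<close> or
  \<open>1\<close>.\<close>

lemma abs_subdets_ladder_mat_le:
  assumes D: "1 \<le> D" and d: "d \<in> abs_subdets (ladder_mat n (\<lambda>i. if i = s then D else 1))"
  shows "d \<le> D"
proof -
  let ?w = "\<lambda>i. if i = s then D else 1" and ?A = "ladder_mat n (\<lambda>i. if i = s then D else 1)"
  obtain I J where IJ: "I \<subseteq> {..<2 * n}" "J \<subseteq> {..<n}" "card I = card J"
    and d: "d = \<bar>det (submatrix ?A I J)\<bar>"
    using d by (auto simp: abs_subdets_def ladder_mat_def)
  have sets: "{i. i < dim_row ?A \<and> i \<in> I} = I" "{j. j < dim_col ?A \<and> j \<in> J} = J"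
    using IJ by (auto simp: ladder_mat_def)
  define k where "k = card I"
  have inI: "pick I i \<in> I" if "i < k" for i
    using that pick_in_set_le k_def by blast
  have inJ: "pick J i \<in> J" if "i < k" for i
    using that pick_in_set_le k_def IJ(3) by metis
  have inj: "inj_on (pick I) {..<k}"
    using pick_mono_le[of _ I] unfolding inj_on_def k_def
    by (metis lessThan_iff linorder_neqE_nat nat_neq_iff)
  have "\<bar>det (submatrix ?A I J)\<bar> \<le> (\<Prod>i<k. ?w (pick I i))"
  proof (rule abs_det_ladder_minor_le[where n = n and c = "pick J"])
    show "submatrix ?A I J \<in> carrier_mat k k"
      using IJ(3) by (intro carrier_matI; simp only: dim_submatrix sets k_def)
    show "pick J i < pick J j" if "i < j" "j < k" for i j
      using that pick_mono_le[of j J i] IJ(3) k_def by simp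
    show "pick J j < n" if "j < k" for j
      using inJ[OF that] IJ(2) by blast
    show "submatrix ?A I J $$ (i, j) = ladder_entry n ?w (pick I i) (pick J j)"
      if "i < k" "j < k" for i j
    proof -
      have "pick I i < 2 * n" "pick J j < n"
        using inI[OF that(1)] inJ[OF that(2)] IJ by blast+
      moreover have "submatrix ?A I J $$ (i, j) = ?A $$ (pick I i, pick J j)"
        using that IJ(3) by (intro submatrix_index; simp only: sets k_def)
      ultimately show ?thesis by (simp add: ladder_mat_def)
    qed
  qed (use D inj in auto)
  also have "\<dots> = (\<Prod>i\<in>pick I ` {..<k}. ?w i)"
    by (simp add: prod.reindex[OF inj])
  also have "\<dots> \<le> D"
    using D by (subst prod.delta) auto
  finally show ?thesis using d by simp
qed

text \<open>The bound is attained by a single entry: row \<open>s\<close> and column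
  \<open>s - 1\<close> hold \<open>- D\<close>.\<close>

lemma abs_subdets_ladder_mat_mem:
  assumes "1 \<le> D" "1 \<le> s" "s < n"
  shows "D \<in> abs_subdets (ladder_mat n (\<lambda>i. if i = s then D else 1))"
proof -
  let ?A = "ladder_mat n (\<lambda>i. if i = s then D else 1)"
  have sets: "{i. i < dim_row ?A \<and> i \<in> {s}} = {s}"
      "{j. j < dim_col ?A \<and> j \<in> {s - 1}} = {s - 1}"
    using assms by (auto simp: ladder_mat_def)
  have pick: "pick {a} 0 = a" for a :: nat
    by (simp add: Least_equality)
  have "submatrix ?A {s} {s - 1} $$ (0, 0) = ?A $$ (pick {s} 0, pick {s - 1} 0)"
    by (intro submatrix_index; simp only: sets; simp)
  also have "\<dots> = - D"
    unfolding pick using assms by (simp add: ladder_mat_def ladder_entry_def)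
  finally have "submatrix ?A {s} {s - 1} $$ (0, 0) = - D" .
  moreover have "submatrix ?A {s} {s - 1} \<in> carrier_mat 1 1"
    by (intro carrier_matI; simp only: dim_submatrix sets; simp)
  ultimately have "\<bar>det (submatrix ?A {s} {s - 1})\<bar> = D"
    using assms by (simp add: det_single)
  then show ?thesis
    unfolding abs_subdets_def using assms
    by (intro CollectI exI[of _ "{s}"] exI[of _ "{s - 1}"]) (auto simp: ladder_mat_def)
qed


section \<open>The instance, its objective and its polyhedron\<close>

text \<open>The extra \<open>1/2\<close> admits no further integer point but ensures that the last coordinate of the
  vertex exceeds \<open>N + 1\<close>, where the objective is already negative, even if \<open>s D = 1\<close>.\<close>
definition ladder_iqp :: "nat \<Rightarrow> int \<Rightarrow> nat \<Rightarrow> iqp" where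
  "ladder_iqp s D N =
     \<lparr>nvars = Suc s, nconc = Suc s,
      quad = vec (Suc s) (\<lambda>_. 1),
      lin = vec (Suc s) (\<lambda>i. if i = s then real N + 1 else 0),
      cmat = ladder_mat (Suc s) (\<lambda>i. if i = s then D else 1),
      rhs = vec (2 * Suc s) (\<lambda>i. if i < s then 2 / 3 else if i = s then real N + 1 / 2 else 0)\<rparr>"

lemma is_instance_ladder_iqp: "is_instance (ladder_iqp s D N)"
  by (simp add: is_instance_def ladder_iqp_def ladder_mat_def)

text \<open>This form separates a concave parabola in the last coordinate, with zeros
  \<open>0\<close> and \<open>N + 1\<close>, from the squares on the ladder.\<close>

lemma objective_ladder_iqp:
  assumes "x \<in> carrier_vec (Suc s)"
  shows "objective (ladder_iqp s D N) x = x $ s * (real N + 1 - x $ s) - (\<Sum>i<s. (x $ i)\<^sup>2)"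
proof -
  have "lin (ladder_iqp s D N) \<bullet> x = (\<Sum>i\<in>{0..<Suc s}. if i = s then (real N + 1) * x $ i else 0)"
    using assms unfolding scalar_prod_def by (intro sum.cong) (auto simp: ladder_iqp_def)
  also have "\<dots> = (real N + 1) * x $ s" by simp
  finally show ?thesis
    unfolding objective_def
    by (simp add: ladder_iqp_def sum_negf power2_eq_square algebra_simps)
qed

lemma ladder_mat_mult_vec:
  assumes "x \<in> carrier_vec n" "i < n"
  shows "(map_mat real_of_int (ladder_mat n w) *\<^sub>v x) $ (n + i) = - x $ i"
    and "(map_mat real_of_int (ladder_mat n w) *\<^sub>v x) $ i =
      x $ i - (if i = 0 then 0 else of_int (w i) * x $ (i - 1))"
proof -
  have row: "(map_mat real_of_int (ladder_mat n w) *\<^sub>v x) $ l =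
      (\<Sum>j\<in>{0..<n}. of_int (ladder_entry n w l j) * x $ j)" if "l < 2 * n" for l
    using that assms(1) by (simp add: scalar_prod_def ladder_mat_def)
  have "(\<Sum>j\<in>{0..<n}. of_int (ladder_entry n w (n + i) j) * x $ j)
      = (\<Sum>j\<in>{0..<n}. if j = i then - x $ j else 0)"
    by (intro sum.cong) (auto simp: ladder_entry_def)
  then show "(map_mat real_of_int (ladder_mat n w) *\<^sub>v x) $ (n + i) = - x $ i"
    using row[of "n + i"] assms(2) by simp
  \<comment> \<open>The row is a sum of two deltas. For \<open>i = 0\<close> the truncated
    \<open>i - 1\<close> is column \<open>0\<close> again, hence the inner case distinction.\<close>
  have "(\<Sum>j\<in>{0..<n}. of_int (ladder_entry n w i j) * x $ j)
      = (\<Sum>j\<in>{0..<n}. (if j = i then x $ j else 0)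
          + (if j = i - 1 then (if i = 0 then 0 else - of_int (w i) * x $ j) else 0))"
    using assms(2) by (intro sum.cong) (auto simp: ladder_entry_def)
  also have "\<dots> = x $ i - (if i = 0 then 0 else of_int (w i) * x $ (i - 1))"
    using assms(2) by (simp add: sum.distrib less_imp_diff_less)
  finally show "(map_mat real_of_int (ladder_mat n w) *\<^sub>v x) $ i =
      x $ i - (if i = 0 then 0 else of_int (w i) * x $ (i - 1))"
    using row[of i] assms(2) by simp
qed

text \<open>Under \<open>1 \<le> s\<close> the first and the last row of the ladder are distinct, so
  row \<open>0\<close> carries the bound \<open>2 / 3\<close> and row \<open>s\<close> has a
  predecessor.\<close>

lemma QP_feasible_ladder_iqp:
  assumes s: "1 \<le> s"
  shows "x \<in> QP_feasible (ladder_iqp s D N) \<longleftrightarrow>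
    x \<in> carrier_vec (Suc s) \<and> (\<forall>i\<le>s. 0 \<le> x $ i) \<and> x $ 0 \<le> 2 / 3 \<and>
    (\<forall>i. Suc i < s \<longrightarrow> x $ Suc i \<le> x $ i + 2 / 3) \<and>
    x $ s \<le> of_int D * x $ (s - 1) + real N + 1 / 2" (is "_ \<longleftrightarrow> _ \<and> ?R")
proof (cases "x \<in> carrier_vec (Suc s)")
  case True
  let ?Ax = "map_mat real_of_int (ladder_mat (Suc s) (\<lambda>i. if i = s then D else 1)) *\<^sub>v x"
  let ?b = "\<lambda>i. if i < s then 2 / 3 else if i = s then real N + 1 / 2 else 0"
  have split: "(\<forall>i<2 * m. Q i) \<longleftrightarrow> (\<forall>i<m. Q i) \<and> (\<forall>i<m. Q (m + i))" for m :: nat and Q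
  proof (intro iffI conjI allI impI)
    fix i assume "(\<forall>i<m. Q i) \<and> (\<forall>i<m. Q (m + i))" and "i < 2 * m"
    then show "Q i"
      by (cases "i < m") (auto dest!: spec[of _ "i - m"])
  qed auto
  have "x \<in> QP_feasible (ladder_iqp s D N) \<longleftrightarrow> (\<forall>i<2 * Suc s. ?Ax $ i \<le> ?b i)"
    using True by (simp add: QP_feasible_def ladder_iqp_def less_eq_vec_def ladder_mat_def)
  also have "\<dots> \<longleftrightarrow> (\<forall>i<Suc s. ?Ax $ i \<le> ?b i) \<and> (\<forall>i<Suc s. ?Ax $ (Suc s + i) \<le> ?b (Suc s + i))"
    by (rule split)
  also have "(\<forall>i<Suc s. ?Ax $ (Suc s + i) \<le> ?b (Suc s + i)) \<longleftrightarrow> (\<forall>i\<le>s. 0 \<le> x $ i)"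
    using ladder_mat_mult_vec(1)[OF True] by (simp add: less_Suc_eq_le)
  also have "(\<forall>i<Suc s. ?Ax $ i \<le> ?b i) \<longleftrightarrow>
      (\<forall>i<Suc s. x $ i - (if i = 0 then 0 else of_int (if i = s then D else 1) * x $ (i - 1)) \<le> ?b i)"
    using ladder_mat_mult_vec(2)[OF True] by simp
  also have "\<dots> \<longleftrightarrow> x $ 0 \<le> 2 / 3 \<and> (\<forall>i. Suc i < s \<longrightarrow> x $ Suc i \<le> x $ i + 2 / 3) \<and>
      x $ s \<le> of_int D * x $ (s - 1) + real N + 1 / 2" (is "?L \<longleftrightarrow> ?M")
  proof
    assume L: ?L
    have "x $ Suc i \<le> x $ i + 2 / 3" if "Suc i < s" for i
      using L[rule_format, of "Suc i"] that by simp
    then show ?M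
      using L[rule_format, of 0] L[rule_format, of s] s by auto
  next
    assume M: ?M
    show ?L
    proof (intro allI impI)
      fix i assume "i < Suc s"
      then show "x $ i - (if i = 0 then 0 else of_int (if i = s then D else 1) * x $ (i - 1)) \<le> ?b i"
        using M s by (cases i; cases "i = s") (auto dest: Suc_lessI simp: diff_le_eq add.commute)
    qed
  qed
  finally show ?thesis using True by blast
next
  case False
  then show ?thesis by (simp add: QP_feasible_def ladder_iqp_def)
qed

section \<open>The continuous optimum\<close>

text \<open>The solution of the first \<open>Suc s\<close> rows taken with equality.\<close>

definition ladder_vertex :: "nat \<Rightarrow> int \<Rightarrow> nat \<Rightarrow> real vec" where
  "ladder_vertex s D N = vec (Suc s)
     (\<lambda>i. if i < s then 2 / 3 * (real i + 1) else 2 / 3 * real s * of_int D + real N + 1 / 2)"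

lemma ladder_vertex_feasible:
  assumes "1 \<le> s" "1 \<le> D"
  shows "ladder_vertex s D N \<in> QP_feasible (ladder_iqp s D N)"
  using assms
  by (auto simp: QP_feasible_ladder_iqp ladder_vertex_def algebra_simps of_nat_diff)

text \<open>Each row bounds a coordinate by a constant plus a nonnegative multiple of the preceding
  coordinate, so the bounds accumulate up the ladder to the point where all of them are
  tight.\<close>

lemma QP_feasible_le_ladder_vertex:
  assumes "1 \<le> s" "1 \<le> D" and x: "x \<in> QP_feasible (ladder_iqp s D N)" and "i \<le> s"
  shows "x $ i \<le> ladder_vertex s D N $ i"
proof -
  note feas = x[unfolded QP_feasible_ladder_iqp[OF assms(1)]]
  have le: "x $ i \<le> 2 / 3 * (real i + 1)" if "i < s" for i
    using that
  proof (induction i)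
    case 0
    then show ?case using feas by simp
  next
    case (Suc i)
    then have "x $ Suc i \<le> x $ i + 2 / 3" "x $ i \<le> 2 / 3 * (real i + 1)"
      using feas by auto
    then show ?case by simp
  qed
  have "x $ (s - 1) \<le> 2 / 3 * real s"
    using le[of "s - 1"] assms(1) by (simp add: of_nat_diff)
  then have "of_int D * x $ (s - 1) \<le> of_int D * (2 / 3 * real s)"
    using assms(2) by (intro mult_left_mono) auto
  then have "x $ s \<le> 2 / 3 * real s * of_int D + real N + 1 / 2"
    using feas by (simp add: algebra_simps)
  then show ?thesis
    using le \<open>i \<le> s\<close> by (cases "i = s") (auto simp: ladder_vertex_def)
qed

text \<open>The vertex maximises every coordinate, hence every square. For the last coordinate the
  gain is \<open>(z - x) (z + x - (N + 1))\<close>, whose second factor is positive because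
  \<open>z\<close> exceeds \<open>N + 1\<close>. Whichever coordinate differs makes the inequality
  strict.\<close>

lemma objective_ladder_vertex_less:
  assumes s: "1 \<le> s" and D: "1 \<le> D" and x: "x \<in> QP_feasible (ladder_iqp s D N)"
    and ne: "x \<noteq> ladder_vertex s D N"
  shows "objective (ladder_iqp s D N) (ladder_vertex s D N) < objective (ladder_iqp s D N) x"
proof -
  define z where "z = ladder_vertex s D N"
  have carrier: "x \<in> carrier_vec (Suc s)" "z \<in> carrier_vec (Suc s)"
    and nonneg: "\<And>i. i \<le> s \<Longrightarrow> 0 \<le> x $ i"
    using x s by (auto simp: QP_feasible_ladder_iqp z_def ladder_vertex_def)
  have le: "x $ i \<le> z $ i" if "i \<le> s" for i
    using QP_feasible_le_ladder_vertex[OF s D x that] by (simp add: z_def)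
  have sq: "(x $ i)\<^sup>2 \<le> (z $ i)\<^sup>2" if "i < s" for i
    using that by (intro power_mono le nonneg) auto
  \<comment> \<open>Since \<open>2 / 3 + 1 / 2 > 1\<close>, this lower bound lifts the vertex above
    \<open>N + 1\<close>.\<close>
  have "1 \<le> real s * of_int D"
    using mult_mono[of 1 "real s" 1 "of_int D"] s D by simp
  then have "z $ s > real N + 1"
    by (simp add: z_def ladder_vertex_def)
  then have pos: "0 < z $ s + x $ s - (real N + 1)"
    using nonneg[of s] by simp
  have diff: "x $ s * (real N + 1 - x $ s) - z $ s * (real N + 1 - z $ s)
      = (z $ s - x $ s) * (z $ s + x $ s - (real N + 1))"
    by (simp add: algebra_simps)
  show ?thesis
  proof (cases "x $ s = z $ s")
    case True
    then obtain i where i: "i < s" "x $ i \<noteq> z $ i"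
      using ne carrier unfolding z_def[symmetric]
      by (metis carrier_vecD eq_vecI less_antisym)
    then have "x $ i < z $ i" using le[of i] by simp
    then have "(x $ i)\<^sup>2 < (z $ i)\<^sup>2"
      using nonneg[of i] i by (intro power_strict_mono) auto
    then have "(\<Sum>i<s. (x $ i)\<^sup>2) < (\<Sum>i<s. (z $ i)\<^sup>2)"
      using i sq by (intro sum_strict_mono_ex1) auto
    then show ?thesis
      using True carrier by (simp add: objective_ladder_iqp z_def[symmetric])
  next
    case False
    then have "0 < (z $ s - x $ s) * (z $ s + x $ s - (real N + 1))"
      using le[of s] pos by (intro mult_pos_pos) auto
    moreover have "(\<Sum>i<s. (x $ i)\<^sup>2) \<le> (\<Sum>i<s. (z $ i)\<^sup>2)"
      using sq by (intro sum_mono) auto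
    ultimately show ?thesis
      using diff carrier by (simp add: objective_ladder_iqp z_def[symmetric])
  qed
qed

lemma optimal_QP_ladder_iqp:
  assumes "1 \<le> s" "1 \<le> D"
  shows "optimal (objective (ladder_iqp s D N)) (QP_feasible (ladder_iqp s D N)) x
    \<longleftrightarrow> x = ladder_vertex s D N"
  using objective_ladder_vertex_less[OF assms] ladder_vertex_feasible[OF assms]
  unfolding optimal_def is_arg_min_def by (metis less_asym')

section \<open>Integer points and approximate solutions\<close>

text \<open>A ladder coordinate exceeds a predecessor already known to be \<open>0\<close> by at
  most \<open>2 / 3\<close>, so integrality makes it \<open>0\<close> too. The \<open>D\<close> term
  then drops out of the last row, and \<open>N + 1 / 2\<close> rounds down to
  \<open>N\<close>.\<close>

lemma IQP_feasible_ladder_iqp: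
  assumes s: "1 \<le> s" and x: "x \<in> IQP_feasible (ladder_iqp s D N)"
  obtains j where "j \<le> N" "x = vec (Suc s) (\<lambda>i. if i = s then real j else 0)"
proof -
  have feas: "x \<in> QP_feasible (ladder_iqp s D N)" and int: "\<And>i. i \<le> s \<Longrightarrow> x $ i \<in> \<int>"
    using x by (auto simp: IQP_feasible_def ladder_iqp_def)
  note feas = feas[unfolded QP_feasible_ladder_iqp[OF s]]
  \<comment> \<open>Applied with \<open>k = 0\<close> on the ladder and with \<open>k = N\<close> to
    the last coordinate.\<close>
  have round: "\<exists>j. j \<le> k \<and> x $ i = real j" if "i \<le> s" "x $ i < real k + 1" for i k
  proof -
    have "x $ i \<in> \<int>" using int that(1) .
    then obtain m where m: "x $ i = of_int m" by (rule Ints_cases)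
    moreover have "0 \<le> x $ i" using feas that(1) by blast
    ultimately have "0 \<le> m" "m < int k + 1" using that(2) by linarith+
    then show ?thesis using m by (intro exI[of _ "nat m"]) auto
  qed
  have zero: "x $ i = 0" if "i < s" for i
    using that
  proof (induction i)
    case 0
    then show ?case using round[of 0 0] feas by simp
  next
    case (Suc i)
    then have "x $ Suc i \<le> 2 / 3" using feas by fastforce
    then show ?case using round[of "Suc i" 0] Suc by simp
  qed
  then have "x $ s < real N + 1" using feas s by auto
  then obtain j where "j \<le> N" "x $ s = real j" using round by blast
  with zero feas show ?thesis
    by (intro that[of j] eq_vecI) (auto simp: less_Suc_eq)
qed

lemma objective_ladder_iqp_integer:
  "objective (ladder_iqp s D N) (vec (Suc s) (\<lambda>i. if i = s then real j else 0))
    = real j * (real N + 1 - real j)"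
  by (simp add: objective_ladder_iqp)

lemma zero_IQP_feasible_ladder_iqp:
  assumes "1 \<le> s"
  shows "0\<^sub>v (Suc s) \<in> IQP_feasible (ladder_iqp s D N)"
  using assms by (simp add: IQP_feasible_def QP_feasible_ladder_iqp) (simp add: ladder_iqp_def)

lemma objective_ladder_iqp_zero: "objective (ladder_iqp s D N) (0\<^sub>v (Suc s)) = 0"
  by (simp add: objective_ladder_iqp)

text \<open>The upper bound is the peak of the parabola, by completing the square. The gap at a
  nonzero point comes from \<open>j (N + 1 - j) - N = (j - 1) (N - j)\<close>, which is nonnegative
  for \<open>1 \<le> j \<le> N\<close>.\<close>

lemma objective_ladder_iqp_bounds:
  assumes s: "1 \<le> s" and x: "x \<in> IQP_feasible (ladder_iqp s D N)"
  shows "0 \<le> objective (ladder_iqp s D N) x"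
    and "objective (ladder_iqp s D N) x \<le> (real N + 1)\<^sup>2 / 4"
    and "x \<noteq> 0\<^sub>v (Suc s) \<Longrightarrow> N \<noteq> 0 \<and> real N \<le> objective (ladder_iqp s D N) x"
proof -
  obtain j where j: "j \<le> N" "x = vec (Suc s) (\<lambda>i. if i = s then real j else 0)"
    using IQP_feasible_ladder_iqp[OF s x] .
  have f: "objective (ladder_iqp s D N) x = real j * (real N + 1 - real j)"
    using j objective_ladder_iqp_integer by simp
  show "0 \<le> objective (ladder_iqp s D N) x" using j f by simp
  have "(real N + 1)\<^sup>2 / 4 - real j * (real N + 1 - real j) = (real N + 1 - 2 * real j)\<^sup>2 / 4"
    by (simp add: power2_eq_square field_simps)
  then show "objective (ladder_iqp s D N) x \<le> (real N + 1)\<^sup>2 / 4"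
    using f by (smt (verit) divide_nonneg_pos zero_le_power2)
  assume "x \<noteq> 0\<^sub>v (Suc s)"
  then have "j \<noteq> 0" using j by (auto simp: zero_vec_def)
  then have "0 \<le> (real j - 1) * (real N - real j)" using j by (intro mult_nonneg_nonneg) auto
  then show "N \<noteq> 0 \<and> real N \<le> objective (ladder_iqp s D N) x"
    using f j \<open>j \<noteq> 0\<close> by (auto simp: algebra_simps)
qed

lemma optimal_IQP_ladder_iqp:
  assumes s: "1 \<le> s"
  shows "optimal (objective (ladder_iqp s D N)) (IQP_feasible (ladder_iqp s D N)) (0\<^sub>v (Suc s))"
  using zero_IQP_feasible_ladder_iqp[OF s] objective_ladder_iqp_bounds(1)[OF s]
  by (auto simp: optimal_def is_arg_min_def objective_ladder_iqp_zero not_less)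

text \<open>A nonzero approximate solution would force \<open>N \<ge> 1\<close> and \<open>N \<le>
  \<epsilon> (N + 1)\<^sup>2 / 4 \<le> N \<epsilon> (N + 3) / 4 < N\<close>.\<close>

lemma eps_approximate_ladder_iqp:
  assumes s: "1 \<le> s" and "0 < \<epsilon>" and small: "N = 0 \<or> \<epsilon> * (real N + 3) < 4"
  shows "eps_approximate \<epsilon> (objective (ladder_iqp s D N)) (IQP_feasible (ladder_iqp s D N)) x
    \<longleftrightarrow> x = 0\<^sub>v (Suc s)"
proof -
  let ?f = "objective (ladder_iqp s D N)" and ?S = "IQP_feasible (ladder_iqp s D N)"
  note zero = zero_IQP_feasible_ladder_iqp[OF s, of D N]
  have bdd: "bdd_above (?f ` ?S)"
    using objective_ladder_iqp_bounds(2)[OF s] by (meson bdd_aboveI2)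
  \<comment> \<open>The definition of approximation asks for some optimal point, so the value has to
    be known at every optimum and not just at the origin.\<close>
  have opt: "?f y = 0" if "optimal ?f ?S y" for y
    using that zero objective_ladder_iqp_bounds(1)[OF s, of y D N]
    unfolding optimal_def is_arg_min_def by (metis objective_ladder_iqp_zero order_le_less)
  have iff: "eps_approximate \<epsilon> ?f ?S x \<longleftrightarrow> x \<in> ?S \<and> ?f x \<le> \<epsilon> * (SUP y\<in>?S. ?f y)"
    unfolding eps_approximate_def using bdd opt optimal_IQP_ladder_iqp[OF s]
    by (metis diff_zero)
  show ?thesis
  proof
    assume "x = 0\<^sub>v (Suc s)"
    moreover have "0 \<le> (SUP y\<in>?S. ?f y)"
      using cSUP_upper[OF zero bdd] by (simp add: objective_ladder_iqp_zero)
    ultimately show "eps_approximate \<epsilon> ?f ?S x"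
      using iff zero \<open>0 < \<epsilon>\<close> by (simp add: objective_ladder_iqp_zero)
  next
    assume approx: "eps_approximate \<epsilon> ?f ?S x"
    then have x: "x \<in> ?S" using iff by blast
    show "x = 0\<^sub>v (Suc s)"
    proof (rule ccontr)
      assume "x \<noteq> 0\<^sub>v (Suc s)"
      then have N: "N \<noteq> 0" "real N \<le> ?f x"
        using objective_ladder_iqp_bounds(3)[OF s x] by auto
      have "(SUP y\<in>?S. ?f y) \<le> (real N + 1)\<^sup>2 / 4"
        by (rule cSUP_least) (use zero objective_ladder_iqp_bounds(2)[OF s] in auto)
      then have "\<epsilon> * (SUP y\<in>?S. ?f y) \<le> \<epsilon> * ((real N + 1)\<^sup>2 / 4)"
        using \<open>0 < \<epsilon>\<close> by (intro mult_left_mono) auto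
      then have "4 * real N \<le> \<epsilon> * (real N + 1)\<^sup>2"
        using approx iff N by simp
      \<comment> \<open>This uses \<open>N \<ge> 1\<close> and trades the square for a multiple of
        \<open>N\<close>, so that \<open>N\<close> cancels at the end of the chain.\<close>
      also have "(real N + 1)\<^sup>2 \<le> real N * (real N + 3)"
        using N(1) by (simp add: power2_eq_square algebra_simps)
      then have "\<epsilon> * (real N + 1)\<^sup>2 \<le> real N * (\<epsilon> * (real N + 3))"
        using \<open>0 < \<epsilon>\<close> mult_left_mono[of _ _ \<epsilon>] by (simp add: mult.left_commute)
      also have "\<dots> < real N * 4"
        using small N(1) by (intro mult_strict_left_mono) auto
      finally show False by simp
    qed
  qed
qed

section \<open>The distance and the asymptotic bound\<close>

text \<open>Both solutions are unique and the approximate one is the origin. As only one distance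
  occurs, the infimum in \<open>delta_star\<close> is attained.\<close>

lemma proximity_distances_ladder_iqp:
  assumes "1 \<le> s" "1 \<le> D" "0 < \<epsilon>" "N = 0 \<or> \<epsilon> * (real N + 3) < 4"
  shows "proximity_distances (ladder_iqp s D N) \<epsilon> = {linf_norm (ladder_vertex s D N)}"
proof -
  have "ladder_vertex s D N - 0\<^sub>v (Suc s) = ladder_vertex s D N"
    by (auto simp: ladder_vertex_def)
  then show ?thesis
    using assms by (simp add: proximity_distances_def eps_approximate_ladder_iqp optimal_QP_ladder_iqp)
qed

lemma linf_norm_ladder_vertex_ge:
  assumes "1 \<le> D"
  shows "real N + 2 / 3 * real s * of_int D \<le> linf_norm (ladder_vertex s D N)"
proof -
  have "\<bar>ladder_vertex s D N $ s\<bar> \<le> linf_norm (ladder_vertex s D N)"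
    unfolding linf_norm_def by (rule Max_ge) (auto simp: ladder_vertex_def)
  moreover have "real N + 2 / 3 * real s * of_int D \<le> ladder_vertex s D N $ s"
    by (simp add: ladder_vertex_def)
  ultimately show ?thesis by linarith
qed

theorem proposition3:
  shows "(\<forall>(n::nat) (\<Delta>::int) (\<epsilon>::real). n \<ge> 2 \<and> \<Delta> \<ge> 1 \<and> 0 < \<epsilon> \<and> \<epsilon> \<le> 1 \<longrightarrow>
            (\<exists>P. is_instance P \<and> nvars P = n \<and> nconc P = n \<and> has_subdeterminant P \<Delta> \<and>
                 (\<exists>x. optimal (objective P) (IQP_feasible P) x) \<and>
                 (\<exists>x. optimal (objective P) (QP_feasible P) x) \<and>
                 delta_star P \<epsilon> \<in> proximity_distances P \<epsilon> \<and>
                 delta_star P \<epsilon> \<ge> 4 * (1 / \<epsilon> - 1) + 2 / 3 * (real n - 1) * real_of_int \<Delta>))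
       \<and> (\<exists>c > 0. \<exists>C > 0. \<forall>(n::nat) (\<Delta>::int) (\<epsilon>::real). n \<ge> 2 \<and> \<Delta> \<ge> 1 \<and> 0 < \<epsilon> \<and> \<epsilon> \<le> 1 \<and>
            1 / \<epsilon> + real n * real_of_int \<Delta> \<ge> C \<longrightarrow>
            4 * (1 / \<epsilon> - 1) + 2 / 3 * (real n - 1) * real_of_int \<Delta>
              \<ge> c * (1 / \<epsilon> + real n * real_of_int \<Delta>))"
proof (intro conjI allI impI)
  fix n :: nat and \<Delta> :: int and \<epsilon> :: real
  assume asm: "n \<ge> 2 \<and> \<Delta> \<ge> 1 \<and> 0 < \<epsilon> \<and> \<epsilon> \<le> 1"
  define s where "s = n - 1"
  have s: "1 \<le> s" "n = Suc s" and \<Delta>: "1 \<le> \<Delta>" and \<epsilon>: "0 < \<epsilon>" "\<epsilon> \<le> 1"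
    using asm by (auto simp: s_def)
  \<comment> \<open>Rounding up yields the term \<open>4 (1 / \<epsilon> - 1)\<close> of the claim,
    while \<open>N < 4 (1 / \<epsilon> - 1) + 1\<close> is the same as
    \<open>N + 3 < 4 / \<epsilon>\<close>, which excludes nonzero approximate solutions.\<close>
  define N where "N = nat \<lceil>4 * (1 / \<epsilon> - 1)\<rceil>"
  have "0 \<le> 4 * (1 / \<epsilon> - 1)" using \<epsilon> by (simp add: le_divide_eq)
  then have N: "4 * (1 / \<epsilon> - 1) \<le> real N" "real N < 4 * (1 / \<epsilon> - 1) + 1"
    unfolding N_def by linarith+
  have "\<epsilon> * (real N + 3) < \<epsilon> * (4 / \<epsilon>)"
    using N(2) \<epsilon> by (intro mult_strict_left_mono) auto
  then have small: "N = 0 \<or> \<epsilon> * (real N + 3) < 4" using \<epsilon> by simp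
  define P where "P = ladder_iqp s \<Delta> N"
  have dist: "proximity_distances P \<epsilon> = {linf_norm (ladder_vertex s \<Delta> N)}"
    unfolding P_def by (rule proximity_distances_ladder_iqp[OF s(1) \<Delta> \<epsilon>(1) small])
  then have delta: "delta_star P \<epsilon> = linf_norm (ladder_vertex s \<Delta> N)"
    by (simp add: delta_star_def)
  show "\<exists>P. is_instance P \<and> nvars P = n \<and> nconc P = n \<and> has_subdeterminant P \<Delta> \<and>
                 (\<exists>x. optimal (objective P) (IQP_feasible P) x) \<and>
                 (\<exists>x. optimal (objective P) (QP_feasible P) x) \<and>
                 delta_star P \<epsilon> \<in> proximity_distances P \<epsilon> \<and>
                 delta_star P \<epsilon> \<ge> 4 * (1 / \<epsilon> - 1) + 2 / 3 * (real n - 1) * real_of_int \<Delta>"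
  proof (intro exI[of _ P] conjI)
    show "is_instance P" "nvars P = n" "nconc P = n"
      using is_instance_ladder_iqp s by (auto simp: P_def ladder_iqp_def)
    show "has_subdeterminant P \<Delta>"
      using abs_subdets_ladder_mat_mem[OF \<Delta> s(1)] abs_subdets_ladder_mat_le[OF \<Delta>]
      by (simp add: has_subdeterminant_def P_def ladder_iqp_def)
    show "\<exists>x. optimal (objective P) (IQP_feasible P) x"
      using optimal_IQP_ladder_iqp[OF s(1)] P_def by blast
    show "\<exists>x. optimal (objective P) (QP_feasible P) x"
      using optimal_QP_ladder_iqp[OF s(1) \<Delta>] P_def by blast
    show "delta_star P \<epsilon> \<in> proximity_distances P \<epsilon>"
      by (simp add: delta dist)
    show "delta_star P \<epsilon> \<ge> 4 * (1 / \<epsilon> - 1) + 2 / 3 * (real n - 1) * real_of_int \<Delta>"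
      using linf_norm_ladder_vertex_ge[OF \<Delta>, of N s] N(1) s by (simp add: delta)
  qed
next
  show "\<exists>c > 0. \<exists>C > 0. \<forall>(n::nat) (\<Delta>::int) (\<epsilon>::real). n \<ge> 2 \<and> \<Delta> \<ge> 1 \<and> 0 < \<epsilon> \<and> \<epsilon> \<le> 1 \<and>
            1 / \<epsilon> + real n * real_of_int \<Delta> \<ge> C \<longrightarrow>
            4 * (1 / \<epsilon> - 1) + 2 / 3 * (real n - 1) * real_of_int \<Delta>
              \<ge> c * (1 / \<epsilon> + real n * real_of_int \<Delta>)"
  \<comment> \<open>With \<open>h = 1 / \<epsilon> + n \<Delta>\<close> and
    \<open>n - 1 \<ge> n / 2\<close>, the bound is at least \<open>h / 3 - 4\<close>, and
    \<open>h \<ge> 24\<close> gives \<open>4 \<le> h / 6\<close>.\<close>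
  proof (rule exI[of _ "1 / 6"], intro conjI, simp, rule exI[of _ 24], intro conjI allI impI, simp)
    fix n :: nat and \<Delta> :: int and \<epsilon> :: real
    assume asm: "n \<ge> 2 \<and> \<Delta> \<ge> 1 \<and> 0 < \<epsilon> \<and> \<epsilon> \<le> 1 \<and>
      1 / \<epsilon> + real n * real_of_int \<Delta> \<ge> 24"
    then have "real n / 2 * real_of_int \<Delta> \<le> (real n - 1) * real_of_int \<Delta>"
      by (intro mult_right_mono) auto
    moreover have "0 < 1 / \<epsilon>" using asm by simp
    ultimately show "4 * (1 / \<epsilon> - 1) + 2 / 3 * (real n - 1) * real_of_int \<Delta>
        \<ge> 1 / 6 * (1 / \<epsilon> + real n * real_of_int \<Delta>)"
      using asm unfolding mult.assoc by argo
  qed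
qed

end
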